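(* Let $m$ be an odd squarefree positive integer. Let $f:\mathbb{Z}_m^*\rightarrow[0,1]$ be an arbitrary function with average larger than $5/8$: $$\sum_{x\in\mathbb{Z}_m^*}f(x)>\tfrac{5}{8}\phi(m).$$ Then for any $x\in\mathbb{Z}_m$, there exist $a_1,a_2,a_3\in\mathbb{Z}_m^*$ with $x=a_1+a_2+a_3$, such that $$f(a_1)f(a_2)f(a_3)>0,\qquad f(a_1)+f(a_2)+f(a_3)>\tfrac{3}{2}.$$
   Context: $\mathbb{Z}_m=\mathbb{Z}/m\mathbb{Z}$, $\mathbb{Z}_m^*$ is the set of reduced residues (units) modulo $m$, and $\phi(m)=|\mathbb{Z}_m^*|$ is Euler's totient function. The elements $a_1,a_2,a_3$ are not required to be distinct. *)

theory Defs
  imports "HOL-Number_Theory.Number_Theory" "HOL-Computational_Algebra.Squarefree"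
begin

(* Z/mZ is represented by the least nonnegative residues {..<m}.  Unlike the library's
   totatives, which are taken from {0<..m}, the units are taken from the same system of
   representatives; the two differ only for m = 1, where the zero ring has the unit 0. *)
definition Zmod :: "nat \<Rightarrow> nat set" where
  "Zmod m = {..<m}"

definition Zmod_units :: "nat \<Rightarrow> nat set" where
  "Zmod_units m = {a \<in> Zmod m. coprime a m}"

end

theory Submission
  imports Defs
begin

text \<open>
  Positivity of a quadratic polynomial \<open>score (f a1) (f a2) (f a3)\<close> implies both conclusions, and it is
  stable under averaging: if \<open>p \<ge> 7\<close> is prime and the averages of three \<open>[0,1]\<close>-valued functions on the
  units modulo \<open>p\<close> have positive score, then every residue is a sum of three units at which the
  values have positive score. To see this, enumerate the values in decreasing order. By
  Cauchy-Davenport it suffices to find indices \<open>i + j + k \<ge> p - 1\<close> with positive score. As the score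
  has degree two and no product of all three variables, the score of the averages is the mean of the
  scores over the Latin square \<open>i + j + k = 0\<close> modulo \<open>p - 1\<close>, in which only \<open>(0, 0, 0)\<close> violates the
  index condition, and this triple is outweighed by those with \<open>i + j + k = 2 * (p - 1)\<close>.
  By the Chinese remainder theorem the stability extends to squarefree moduli coprime to 30,
  which leaves the moduli dividing 15. There the units split into two classes modulo 3 and,
  for two functions on the units modulo 5 with average sum above \<open>5/4\<close>, a suitable triple is found
  by linear programming.
\<close>

section \<open>The score\<close>

text \<open>The bilinear terms are chosen such that \<open>score\<close> is nonnegative on the segment
  \<open>(u, u, 5/4 - u)\<close> for \<open>1/4 \<le> u \<le> 1\<close>, with a zero at the extremal point \<open>(1/4, 1/4, 1)\<close>, and is not
  positive at \<open>(0, 1, 1)\<close>, \<open>(1, 0, 1)\<close> and \<open>(1, 1, 0)\<close>.\<close>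

definition score :: "real \<Rightarrow> real \<Rightarrow> real \<Rightarrow> real" where
  "score a b c = 8 * a * b + 2 * a * c + 2 * b * c - a - b + 5 * c - 6"

lemma score_commute: "score a b c = score b a c"
  by (simp add: score_def algebra_simps)

text \<open>Where the score is positive it is increasing in each argument: in the first one it is affine,
  and its value at \<open>x = 0\<close> is never positive.\<close>

lemma score_mono:
  assumes "score x y z > 0" "0 \<le> x" "x \<le> a" "a \<le> 1" "0 \<le> y" "y \<le> b" "b \<le> 1" "0 \<le> z" "z \<le> c" "c \<le> 1"
  shows "score a b c > 0"
proof -
  have left: "score a y z > 0"
    if "score x y z > 0" "0 \<le> x" "x \<le> a" "0 \<le> y" "y \<le> 1" "z \<le> 1" "z \<ge> 0" for a x y z :: real
  proof -
    have e: "score x y z = x * (8 * y + 2 * z - 1) - (6 - 5 * z + y - 2 * y * z)"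
      by (simp add: score_def algebra_simps)
    have "y * z \<le> 1" "y * z \<le> y"
      using that by (auto intro: mult_le_one mult_left_le)
    then have "6 - 5 * z + y - 2 * y * z \<ge> 0" using that by linarith
    then have "x * (8 * y + 2 * z - 1) > 0" using e that by linarith
    then have "8 * y + 2 * z - 1 > 0" using that by (simp add: zero_less_mult_iff)
    then have "x * (8 * y + 2 * z - 1) \<le> a * (8 * y + 2 * z - 1)" using that by (intro mult_right_mono) auto
    then show ?thesis using that by (simp add: score_def algebra_simps)
  qed
  have "score a y z > 0" using left[of x y z a] assms by auto
  then have "score y a z > 0" by (simp add: score_commute)
  then have "score b a z > 0" using left[of y a z b] assms by auto
  then have 1: "score a b z > 0" by (simp add: score_commute)
  have "score a b c = score a b z + (c - z) * (5 + 2 * a + 2 * b)" by (simp add: score_def algebra_simps)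
  moreover have "(c - z) * (5 + 2 * a + 2 * b) \<ge> 0" using assms by (intro mult_nonneg_nonneg) auto
  ultimately show ?thesis using 1 by linarith
qed

text \<open>If \<open>a\<close> were zero, monotonicity would make the score positive at (0, 1, 1),
  where it vanishes.\<close>

lemma score_pos_left:
  assumes "score a b c > 0" "0 \<le> a" "a \<le> 1" "0 \<le> b" "b \<le> 1" "0 \<le> c" "c \<le> 1"
  shows "a > 0"
proof (rule ccontr)
  assume "\<not> a > 0"
  then have "score 0 1 1 > 0" using score_mono[of a b c 0 1 1] assms by auto
  then show False by (simp add: score_def)
qed

lemma score_pos_last:
  assumes "score a b c > 0" "0 \<le> a" "a \<le> 1" "0 \<le> b" "b \<le> 1" "0 \<le> c" "c \<le> 1"
  shows "c > 0"
proof (rule ccontr)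
  assume "\<not> c > 0"
  then have "score 1 1 0 > 0" using score_mono[of a b c 1 1 0] assms by auto
  then show False by (simp add: score_def)
qed

text \<open>AM-GM bounds the score in terms of \<open>s = a + b\<close> and \<open>c\<close>,
  increasingly in \<open>c\<close>. The binding constraint is \<open>c \<le> 3/2 - s\<close> for
  \<open>s \<ge> 1/2\<close> and \<open>c \<le> 1\<close> otherwise.\<close>

lemma score_pos_sum:
  assumes "score a b c > 0" "0 \<le> a" "a \<le> 1" "0 \<le> b" "b \<le> 1" "0 \<le> c" "c \<le> 1"
  shows "a + b + c > 3 / 2"
proof (rule ccontr)
  assume n: "\<not> a + b + c > 3 / 2"
  define s where "s = a + b"
  have "(a - b)\<^sup>2 \<ge> 0" by simp
  then have "8 * a * b \<le> 2 * s\<^sup>2" by (simp add: s_def power2_eq_square algebra_simps)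
  then have 1: "score a b c \<le> 2 * s\<^sup>2 - s - 6 + c * (2 * s + 5)"
    by (simp add: score_def s_def algebra_simps)
  show False
  proof (cases "s \<ge> 1/2")
    case True
    have "c * (2 * s + 5) \<le> (3/2 - s) * (2 * s + 5)"
      using n True by (intro mult_right_mono) (auto simp: s_def)
    then show False using 1 assms(1) True by (simp add: power2_eq_square algebra_simps)
  next
    case False
    have "c * (2 * s + 5) \<le> 1 * (2 * s + 5)"
      using assms by (intro mult_right_mono) (auto simp: s_def)
    moreover have "(2 * s - 1) * (s + 1) < 0"
      using False assms by (intro mult_neg_pos) (auto simp: s_def)
    ultimately show False using 1 assms(1) by (simp add: power2_eq_square algebra_simps)
  qed
qed

text \<open>The factor 10 is available because Lemma \<open>score_avg_nonpos\<close> has ten good triples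
  to compensate for its only bad one.\<close>

lemma score_corner_bound:
  assumes "0 \<le> x" "x \<le> a" "a \<le> 1" "0 \<le> y" "y \<le> b" "b \<le> 1" "0 \<le> z" "z \<le> c" "c \<le> 1"
    and "score a y z \<le> 0" "score x b z \<le> 0" "score x y c \<le> 0"
  shows "score a b c \<le> - 10 * score x y z"
proof -
  define f where "f = - score x y z"
  have fc: "score x y c = - f + (c - z) * (5 + 2 * x + 2 * y)" by (simp add: f_def score_def algebra_simps)
  have r0: "(c - z) * (5 + 2 * x + 2 * y) \<ge> 0" using assms by (intro mult_nonneg_nonneg) auto
  have rf: "(c - z) * (5 + 2 * x + 2 * y) \<le> f" using fc assms by linarith
  have f0: "f \<ge> 0" using rf r0 by linarith
  show ?thesis
  \<comment> \<open>The score never exceeds 9, its value at (1, 1, 1), so a large deficit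
    \<open>f\<close> settles the claim.\<close>
  proof (cases "f \<ge> 9/10")
    case True
    have "score a b c \<le> 9"
    proof -
      have "a * b \<le> 1" "a * c \<le> a" "b * c \<le> b"
        using assms by (auto intro: mult_le_one mult_left_le)
      then show ?thesis using assms by (simp add: score_def)
    qed
    then show ?thesis using True by (simp add: f_def)
  next
    case False
    \<comment> \<open>\<open>P\<close> and \<open>Q\<close> are the slopes of the score in its first
      two arguments at (x, y, z).\<close>
    define P where "P = 8 * y + 2 * z - 1"
    define Q where "Q = 8 * x + 2 * z - 1"
    define s where "s = a - x"
    define t where "t = b - y"
    have s0: "s \<ge> 0" "t \<ge> 0" using assms by (auto simp: s_def t_def)
    \<comment> \<open>As \<open>z \<le> 1\<close>, this identity gives
      \<open>P * Q \<ge> 9 - 8 * f\<close>: a small deficit forces a large product of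
      slopes.\<close>
    have E: "8 * f = 4 * z\<^sup>2 - 44 * z + 49 - P * Q"
      by (simp add: f_def score_def P_def Q_def power2_eq_square algebra_simps)
    have "(1 - z) * (10 - z) \<ge> 0" using assms by (intro mult_nonneg_nonneg) auto
    then have E9: "4 * z\<^sup>2 - 44 * z + 49 \<ge> 9" by (simp add: power2_eq_square algebra_simps)
    have PQ: "P * Q > 9/5" using E E9 False by linarith
    have lb: "P \<ge> -1" "Q \<ge> -1" using assms(1,4,7) unfolding P_def Q_def by linarith+
    have pos: "P > 0 \<and> Q > 0"
    proof (rule ccontr)
      assume "\<not> (P > 0 \<and> Q > 0)"
      moreover have "0 < P * Q" using PQ by linarith
      ultimately have "P < 0 \<and> Q < 0" by (auto simp: zero_less_mult_iff)
      then have "(- P) * (- Q) \<le> 1 * 1" using lb by (intro mult_mono) auto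
      then show False using PQ by simp
    qed
    have sP: "s * P \<le> f" "t * Q \<le> f"
      using assms(10,11) by (simp_all add: s_def t_def P_def Q_def f_def score_def algebra_simps)
    have "(s * P) * (t * Q) \<le> f * f" using sP f0 s0 pos by (intro mult_mono) auto
    then have "(s * t) * (P * Q) \<le> f * f" by (simp add: algebra_simps)
    moreover have "f * f \<le> (9/10 * f) * (P * Q)"
    proof -
      have "f \<le> 9/10 * (P * Q)" using E E9 False by linarith
      then have "f * f \<le> f * (9/10 * (P * Q))" using f0 by (intro mult_left_mono)
      then show ?thesis by (simp add: algebra_simps)
    qed
    ultimately have "(s * t) * (P * Q) \<le> (9/10 * f) * (P * Q)" by linarith
    then have st: "s * t \<le> 9/10 * f" by (rule mult_right_le_imp_le) (use PQ in linarith)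
    have "(c - z) * (5 + 2 * a + 2 * b) \<le> 9/5 * f"
    proof -
      have "(c - z) * (5 + 2 * a + 2 * b) \<le> (c - z) * 9" using assms by (intro mult_left_mono) auto
      moreover have "(c - z) * 5 \<le> (c - z) * (5 + 2 * x + 2 * y)" using assms by (intro mult_left_mono) auto
      ultimately show ?thesis using rf by linarith
    qed
    \<comment> \<open>The increments are at most \<open>f\<close>, \<open>f\<close>,
      \<open>36/5 * f\<close> and \<open>9/5 * f\<close>; with \<open>- f\<close> they add up to
      \<open>10 * f\<close>.\<close>
    moreover have "score a b c = - f + s * P + t * Q + 8 * (s * t) + (c - z) * (5 + 2 * a + 2 * b)"
      by (simp add: s_def t_def P_def Q_def f_def score_def algebra_simps)
    ultimately show ?thesis using sP st by (simp add: f_def)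
  qed
qed

text \<open>A polyhedral inner approximation of the region of positive score, which makes the case analysis
  modulo 5 linear.\<close>

lemma score_pos_aux:
  assumes "0 \<le> a" "a \<le> b" "b \<le> 1" "a + b + 2 * c > 5/2" "3 * a + b + 3 * c > 4"
  shows "score a b c > 0"
proof -
  have w: "5 + 2 * a + 2 * b > 0" using assms by linarith
  have e: "score a b c = (5 + 2 * a + 2 * b) * (c - 1) + 8 * a * b + a + b - 1"
    by (simp add: score_def algebra_simps)
  show ?thesis
  \<comment> \<open>The last two hypotheses are lower bounds for \<open>c\<close>, and they coincide
    at this threshold. Inserting the stronger one leaves a quadratic in \<open>a\<close> and
    \<open>b\<close>, certified nonnegative as a sum of products.\<close>
  proof (cases "b \<le> 3 * a - 1/2")
    case True
    have "(5 + 2 * a + 2 * b) * (c - 1) > (5 + 2 * a + 2 * b) * (1/4 - a / 2 - b / 2)"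
      using assms w by (intro mult_strict_left_mono; linarith)
    moreover have "(b - a) * (3 * a - 1/2 - b) + (2 * a - 1/2) * (a + b - 1/2) \<ge> 0"
      using assms True by (intro add_nonneg_nonneg mult_nonneg_nonneg) auto
    ultimately show ?thesis unfolding e
      by (simp add: algebra_simps add_divide_distrib diff_divide_distrib)
  next
    case False
    have 1: "(5 + 2 * a + 2 * b) * (c - 1) > (5 + 2 * a + 2 * b) * (1/3 - a - b / 3)"
      using assms w by (intro mult_strict_left_mono; linarith)
    have "8 * a * b - 3 * a\<^sup>2 - b\<^sup>2 - 5 * a + 1 \<ge> 0"
    proof (cases "a \<ge> 1/4")
      case True
      have "(1 - b) * (b - (3 * a - 1/2)) + (5 * a - 1/2) * (b - (3 * a - 1/2)) + 12 * (a - 1/4)\<^sup>2 \<ge> 0"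
        using assms True False by (intro add_nonneg_nonneg mult_nonneg_nonneg; (linarith | simp))
      then show ?thesis
        by (simp add: power2_eq_square algebra_simps add_divide_distrib diff_divide_distrib)
    next
      case False
      have "(1 - b) * (b - a) + (1 - b) * (1 - 4 * a) + 3 * a * (b - a) \<ge> 0"
        using assms False by (intro add_nonneg_nonneg mult_nonneg_nonneg) auto
      then show ?thesis by (simp add: power2_eq_square algebra_simps)
    qed
    then show ?thesis using 1 unfolding e by (simp add: power2_eq_square algebra_simps)
  qed
qed

lemma score_pos_if_linear:
  assumes "0 \<le> a" "a \<le> 1" "0 \<le> b" "b \<le> 1"
    and "a + b + 2 * c > 5/2" "3 * a + b + 3 * c > 4" "a + 3 * b + 3 * c > 4"
  shows "score a b c > 0"
proof (cases "a \<le> b")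
  case True then show ?thesis using score_pos_aux assms by blast
next
  case False
  then have "score b a c > 0" using assms by (intro score_pos_aux) auto
  then show ?thesis by (simp add: score_commute)
qed

text \<open>Here the first linear condition reads \<open>a + c > 5/4\<close>; as
  \<open>c \<le> 1\<close>, it forces \<open>a > 1/4\<close>, which yields the other two.\<close>

lemma score_diag_pos:
  assumes "0 \<le> a" "a \<le> 1" "c \<le> 1" "a + c > 5/4"
  shows "score a a c > 0"
  using assms by (intro score_pos_if_linear) auto

lemma score_nonpos_cases:
  assumes "score a b c \<le> 0" "0 \<le> a" "a \<le> 1" "0 \<le> b" "b \<le> 1"
  shows "a + b + 2 * c \<le> 5/2 \<or> 3 * a + b + 3 * c \<le> 4 \<or> a + 3 * b + 3 * c \<le> 4"
  using score_pos_if_linear[of a b c] assms by linarith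

section \<open>Averages of decreasing sequences\<close>

text \<open>The representative of \<open>-(i + j)\<close> modulo \<open>n\<close>, for \<open>i, j < n\<close>. Except at \<open>i = j = 0\<close> the sum
  \<open>i + j + latin n i j\<close> is \<open>n\<close> or \<open>2 * n\<close>.\<close>

definition latin :: "nat \<Rightarrow> nat \<Rightarrow> nat \<Rightarrow> nat" where
  "latin n i j = (if i + j = 0 then 0 else if i + j \<le> n then n - i - j else 2 * n - i - j)"

lemma latin_less: "i < n \<Longrightarrow> j < n \<Longrightarrow> latin n i j < n"
  by (auto simp: latin_def)

lemma latin_latin: "i < n \<Longrightarrow> j < n \<Longrightarrow> latin n i (latin n i j) = j"
  by (auto simp: latin_def split: if_splits)

lemma latin_commute: "latin n i j = latin n j i"
  by (auto simp: latin_def)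

lemma sum_latin:
  assumes "i < n"
  shows "(\<Sum>j<n. g (latin n i j)) = (\<Sum>k<n. g k)"
proof -
  have "bij_betw (latin n i) {..<n} {..<n}"
    using assms by (intro bij_betw_byWitness[where f' = "latin n i"]) (auto simp: latin_latin latin_less)
  then show ?thesis by (rule sum.reindex_bij_betw)
qed

text \<open>Any two coordinates of \<open>(i, j, latin n i j)\<close> run through all pairs of
  indices exactly once, so each bilinear term sums to a product of sums.\<close>

lemma sum_score_latin:
  fixes a b c :: "nat \<Rightarrow> real"
  assumes "n > 0"
  shows "(\<Sum>i<n. \<Sum>j<n. score (a i) (b j) (c (latin n i j))) =
    (real n)\<^sup>2 * score ((\<Sum>i<n. a i) / n) ((\<Sum>i<n. b i) / n) ((\<Sum>i<n. c i) / n)"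
proof -
  define sa where "sa = (\<Sum>i<n. a i)"
  define sb where "sb = (\<Sum>i<n. b i)"
  define sc where "sc = (\<Sum>i<n. c i)"
  have 1: "(\<Sum>i<n. \<Sum>j<n. a i * b j) = sa * sb"
    by (simp add: sa_def sb_def sum_product)
  have "(\<Sum>i<n. \<Sum>j<n. a i * c (latin n i j)) = (\<Sum>i<n. a i * sc)"
    by (intro sum.cong) (simp_all add: sum_distrib_left[symmetric] sum_latin sc_def)
  then have 2: "(\<Sum>i<n. \<Sum>j<n. a i * c (latin n i j)) = sa * sc"
    by (simp add: sa_def sum_distrib_right)
  have "(\<Sum>i<n. \<Sum>j<n. b j * c (latin n i j)) = (\<Sum>j<n. \<Sum>i<n. b j * c (latin n j i))"
    by (subst sum.swap) (simp add: latin_commute)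
  also have "\<dots> = (\<Sum>j<n. b j * sc)"
    by (intro sum.cong) (simp_all add: sum_distrib_left[symmetric] sum_latin sc_def)
  finally have 3: "(\<Sum>i<n. \<Sum>j<n. b j * c (latin n i j)) = sb * sc"
    by (simp add: sb_def sum_distrib_right)
  have m1: "(\<Sum>i<n. \<Sum>j<n. 8 * (a i * b j)) = 8 * (sa * sb)"
    by (subst 1[symmetric]) (simp add: sum_distrib_left)
  have m2: "(\<Sum>i<n. \<Sum>j<n. 2 * (a i * c (latin n i j))) = 2 * (sa * sc)"
    by (subst 2[symmetric]) (simp add: sum_distrib_left)
  have m3: "(\<Sum>i<n. \<Sum>j<n. 2 * (b j * c (latin n i j))) = 2 * (sb * sc)"
    by (subst 3[symmetric]) (simp add: sum_distrib_left)
  have 4: "(\<Sum>i<n. \<Sum>j<n. a i) = n * sa" "(\<Sum>i<n. \<Sum>j<n. b j) = n * sb"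
    by (simp_all add: sa_def sb_def sum_distrib_left)
  have 5: "(\<Sum>i<n. \<Sum>j<n. 5 * c (latin n i j)) = 5 * (n * sc)"
    by (simp add: sum_latin sc_def sum_distrib_left[symmetric])
  have "(\<Sum>i<n. \<Sum>j<n. score (a i) (b j) (c (latin n i j))) =
     (\<Sum>i<n. \<Sum>j<n. 8 * (a i * b j) + 2 * (a i * c (latin n i j)) + 2 * (b j * c (latin n i j))
        - a i - b j + 5 * c (latin n i j) - 6)"
    by (simp add: score_def algebra_simps)
  also have "\<dots> = 8 * (sa * sb) + 2 * (sa * sc) + 2 * (sb * sc) - n * sa - n * sb + 5 * (n * sc)
      - 6 * (real n)\<^sup>2"
    by (simp only: sum.distrib sum_subtractf m1 m2 m3 4 5)
       (simp add: power2_eq_square)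
  also have "\<dots> = (real n)\<^sup>2 * score (sa / n) (sb / n) (sc / n)"
    using assms by (simp add: score_def field_simps power2_eq_square)
  finally show ?thesis by (simp add: sa_def sb_def sc_def)
qed

lemma score_avg_nonpos:
  fixes a b c :: "nat \<Rightarrow> real"
  assumes n: "n \<ge> 6"
    and dec: "\<And>i j. i \<le> j \<Longrightarrow> j < n \<Longrightarrow> a j \<le> a i" "\<And>i j. i \<le> j \<Longrightarrow> j < n \<Longrightarrow> b j \<le> b i"
      "\<And>i j. i \<le> j \<Longrightarrow> j < n \<Longrightarrow> c j \<le> c i"
    and range: "\<And>i. i < n \<Longrightarrow> a i \<in> {0..1}" "\<And>i. i < n \<Longrightarrow> b i \<in> {0..1}" "\<And>i. i < n \<Longrightarrow> c i \<in> {0..1}"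
    and nonpos: "\<And>i j k. i < n \<Longrightarrow> j < n \<Longrightarrow> k < n \<Longrightarrow> n \<le> i + j + k \<Longrightarrow> score (a i) (b j) (c k) \<le> 0"
  shows "score ((\<Sum>i<n. a i) / n) ((\<Sum>i<n. b i) / n) ((\<Sum>i<n. c i) / n) \<le> 0"
proof -
  define t where "t = (\<lambda>(i, j). score (a i) (b j) (c (latin n i j)))"
  define S where "S = {..<n} \<times> {..<n}"
  \<comment> \<open>\<open>D\<close> holds the pairs \<open>(n - p, n - q)\<close> with
    \<open>p, q \<ge> 1\<close> and \<open>p + q \<le> 5\<close>; their third index is
    \<open>p + q\<close>, as \<open>n \<ge> 6\<close>. There are 4 + 3 + 2 + 1 of them.\<close>
  define E where "E = (SIGMA p:{1..4::nat}. {1..5 - p})"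
  define D where "D = (\<lambda>(p, q). (n - p, n - q)) ` E"
  have fin: "finite S" by (simp add: S_def)
  have "inj_on (\<lambda>(p, q). (n - p, n - q)) E"
    using n by (auto simp: inj_on_def E_def)
  then have "card D = card E" by (simp add: D_def card_image)
  also have "card E = 10" by (simp add: E_def eval_nat_numeral)
  finally have cardD: "card D = 10" .
  have DS: "D \<subseteq> S - {(0, 0)}" using n by (auto simp: D_def E_def S_def)
  have neg: "t x \<le> 0" if "x \<in> S - {(0, 0)}" for x
  proof -
    obtain i j where x: "x = (i, j)" by (cases x)
    have ij: "i < n" "j < n" "i + j \<noteq> 0" using that by (auto simp: x S_def)
    then have "n \<le> i + j + latin n i j" by (auto simp: latin_def)
    then show ?thesis using ij by (auto simp: x t_def intro!: nonpos latin_less)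
  qed
  have comp: "t (0, 0) \<le> - 10 * t x" if xD: "x \<in> D" for x
  proof -
    obtain y where y: "y \<in> E" "x = (case y of (p, q) \<Rightarrow> (n - p, n - q))"
      using xD unfolding D_def by blast
    obtain p q where "y = (p, q)" by (cases y)
    with y have x: "x = (n - p, n - q)" and "(p, q) \<in> E" by auto
    then have pq: "1 \<le> p" "1 \<le> q" "p + q \<le> 5" by (auto simp: E_def)
    have l: "latin n (n - p) (n - q) = p + q" using pq n by (auto simp: latin_def)
    have r: "n - p < n" "n - q < n" "p + q < n" "0 < n" using pq n by auto
    have "score (a 0) (b 0) (c 0) \<le> - 10 * score (a (n - p)) (b (n - q)) (c (p + q))"
    proof (rule score_corner_bound)
      \<comment> \<open>Replacing one index by 0 leaves the index sums \<open>n + p\<close>,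
        \<open>n + q\<close> and \<open>2 * n - p - q\<close>, still at least
        \<open>n\<close>.\<close>
      show "score (a 0) (b (n - q)) (c (p + q)) \<le> 0" "score (a (n - p)) (b 0) (c (p + q)) \<le> 0"
        "score (a (n - p)) (b (n - q)) (c 0) \<le> 0"
        using pq n r by (intro nonpos; simp)+
    qed (use range[OF r(1)] range[OF r(2)] range[OF r(3)] range[OF r(4)] dec[of 0] r in auto)
    then show ?thesis by (simp add: t_def x l) (simp add: latin_def)
  qed
  \<comment> \<open>The maximum with 0 also covers a nonpositive corner score; each of the ten terms
    then absorbs \<open>m / 10\<close>.\<close>
  define m where "m = max 0 (t (0, 0))"
  have "sum t S = t (0, 0) + sum t (S - {(0, 0)})"
    using n fin by (intro sum.remove) (auto simp: S_def)
  also have "sum t (S - {(0, 0)}) = sum t (S - {(0, 0)} - D) + sum t D"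
    using DS fin by (intro sum.subset_diff) auto
  also have "sum t (S - {(0, 0)} - D) \<le> 0" using neg by (intro sum_nonpos) auto
  also have "sum t D \<le> of_nat (card D) * (- m / 10)"
  proof (rule sum_bounded_above)
    fix x assume x: "x \<in> D"
    then have "t x \<le> 0" using neg DS by blast
    with comp[OF x] show "t x \<le> - m / 10" by (auto simp: m_def max_def)
  qed
  finally have "sum t S \<le> 0" by (simp add: cardD m_def)
  moreover have "sum t S = (\<Sum>i<n. \<Sum>j<n. score (a i) (b j) (c (latin n i j)))"
    by (simp add: S_def t_def sum.cartesian_product)
  moreover have "(real n)\<^sup>2 > 0" using n by simp
  ultimately show ?thesis using n by (simp add: sum_score_latin mult_le_0_iff)
qed

section \<open>The Cauchy-Davenport theorem\<close>

definition sumset :: "nat \<Rightarrow> nat set \<Rightarrow> nat set \<Rightarrow> nat set" where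
  "sumset p A B = (\<lambda>(x, y). (x + y) mod p) ` (A \<times> B)"

lemma sumsetI: "x \<in> A \<Longrightarrow> y \<in> B \<Longrightarrow> (x + y) mod p \<in> sumset p A B"
  by (auto simp: sumset_def)

lemma finite_sumset: "finite A \<Longrightarrow> finite B \<Longrightarrow> finite (sumset p A B)"
  by (simp add: sumset_def)

lemma inj_on_add_mod: "inj_on (\<lambda>x. (x + e) mod p) {..<p}" for p :: nat
proof (rule inj_onI)
  fix x y assume "x \<in> {..<p}" "y \<in> {..<p}" "(x + e) mod p = (y + e) mod p"
  then have "[x = y] (mod p)" by (simp add: cong_def[symmetric] cong_add_rcancel_nat)
  with \<open>x \<in> _\<close> \<open>y \<in> _\<close> show "x = y" by (simp add: cong_less_modulus_unique_nat)
qed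

lemma card_add_mod: "A \<subseteq> {..<p} \<Longrightarrow> card ((\<lambda>x. (x + e) mod p) ` A) = card A" for p :: nat
  by (intro card_image inj_on_subset[OF inj_on_add_mod])

text \<open>The multiples of \<open>d\<close> run through all residues, because \<open>d\<close> is
  invertible modulo \<open>p\<close>.\<close>

lemma shift_invariant_eq:
  fixes p d :: nat
  assumes "coprime d p" "A \<subseteq> {..<p}" "A \<noteq> {}" and inv: "\<And>x. x \<in> A \<Longrightarrow> (x + d) mod p \<in> A"
  shows "A = {..<p}"
proof -
  obtain a where a: "a \<in> A" using assms by auto
  have multiples: "(a + k * d) mod p \<in> A" for k
  proof (induction k)
    case 0
    then show ?case using a assms by (auto simp: subset_iff)
  next
    case (Suc k)
    have "(a + Suc k * d) mod p = ((a + k * d) mod p + d) mod p" by (simp add: mod_simps algebra_simps)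
    then show ?case using inv[OF Suc] by simp
  qed
  obtain e where e: "[d * e = 1] (mod p)" using cong_solve_coprime_nat[OF assms(1)] by auto
  have "x \<in> A" if x: "x < p" for x
  proof -
    \<comment> \<open>Shifting \<open>e * (x - a)\<close> times by \<open>d\<close> leads from
      \<open>a\<close> to \<open>x\<close>; \<open>p - a\<close> stands for
      \<open>- a\<close>.\<close>
    have "[d * e * (x + (p - a)) = 1 * (x + (p - a))] (mod p)" by (intro cong_mult e cong_refl)
    then have "[a + (e * (x + (p - a))) * d = a + (x + (p - a))] (mod p)"
      by (intro cong_add cong_refl) (simp add: ac_simps)
    moreover have "a + (x + (p - a)) = x + p" using a assms by auto
    ultimately have "(a + (e * (x + (p - a))) * d) mod p = x" using x by (simp add: cong_def)
    then show ?thesis using multiples[of "e * (x + (p - a))"] by simp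
  qed
  then show ?thesis using assms(2) by auto
qed

lemma card_le_card_sumset:
  assumes "A \<subseteq> {..<p}" "finite B" "b \<in> B"
  shows "card A \<le> card (sumset p A B)"
proof -
  have "finite A" using assms(1) finite_subset by blast
  have "card A = card ((\<lambda>x. (x + b) mod p) ` A)" using assms by (simp add: card_add_mod)
  also have "\<dots> \<le> card (sumset p A B)"
    using assms \<open>finite A\<close> by (intro card_mono finite_sumset) (auto intro: sumsetI)
  finally show ?thesis .
qed

text \<open>Induction on \<open>card B\<close>: passing to the union and the intersection of
  \<open>A\<close> with a translate of \<open>B\<close> keeps the total size and does not enlarge
  the sumset, while the second set shrinks.\<close>

theorem Cauchy_Davenport:
  assumes "prime p" "A \<subseteq> {..<p}" "B \<subseteq> {..<p}" "A \<noteq> {}" "B \<noteq> {}"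
  shows "min p (card A + card B - 1) \<le> card (sumset p A B)"
  using assms
proof (induction "card B" arbitrary: A B rule: less_induct)
  case less
  have fin: "finite A" "finite B" using less.prems finite_subset by blast+
  obtain b1 where b1: "b1 \<in> B" using less.prems by auto
  have cA: "card A \<le> card (sumset p A B)" using less.prems fin b1 by (intro card_le_card_sumset)
  consider "card B = 1" | "A = {..<p}" | "card B \<noteq> 1" "A \<noteq> {..<p}" by blast
  then show ?case
  proof cases
    case 1
    then show ?thesis using cA by simp
  next
    case 2
    then have "card A = p" by simp
    then show ?thesis using cA by simp
  next
    case 3
    have "\<not> B \<subseteq> {b1}" using 3(1) b1 by (auto simp: subset_singleton_iff)
    then obtain b2 where b2: "b2 \<in> B" "b2 \<noteq> b1" by auto
    have lt: "b1 < p" "b2 < p" using b1 b2 less.prems by auto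
    \<comment> \<open>A representative of \<open>b2 - b1\<close>. Being a proper subset,
      \<open>A\<close> is not invariant under this shift.\<close>
    define d where "d = b2 + p - b1"
    have "\<not> [b2 = b1] (mod p)" using lt b2 by (auto simp: cong_less_modulus_unique_nat)
    moreover have "[b2 = b1] (mod p)" if "p dvd d"
    proof -
      have "[d + b1 = 0 + b1] (mod p)" using that by (intro cong_add) (auto simp: cong_0_iff)
      moreover have "d + b1 = b2 + p" using lt by (simp add: d_def)
      ultimately show ?thesis by (simp add: cong_def)
    qed
    ultimately have "\<not> p dvd d" by blast
    then have "coprime d p" using less.prems(1) by (metis prime_imp_coprime coprime_commute)
    then obtain a where a: "a \<in> A" "(a + d) mod p \<notin> A"
      using shift_invariant_eq[of d p A] 3(2) less.prems by blast
    \<comment> \<open>Dyson's transform: translate \<open>B\<close> such that it meets \<open>A\<close> without being contained in it.\<close>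
    define e where "e = a + p - b1"
    define B' where "B' = (\<lambda>y. (y + e) mod p) ` B"
    have "p > 0" using lt by simp
    have B'p: "B' \<subseteq> {..<p}" using \<open>p > 0\<close> by (auto simp: B'_def)
    have finB': "finite B'" using fin by (simp add: B'_def)
    have cB': "card B' = card B" using less.prems by (simp add: B'_def card_add_mod)
    have "b1 + e = a + p" using lt by (simp add: e_def)
    then have "(b1 + e) mod p = a" using a less.prems by auto
    then have aB': "a \<in> B'" using b1 by (force simp: B'_def)
    have "b2 + e = a + d" using lt by (simp add: e_def d_def)
    then have adB': "(a + d) mod p \<in> B'" using b2 by (force simp: B'_def)
    define A1 where "A1 = A \<union> B'"
    define B1 where "B1 = A \<inter> B'"
    \<comment> \<open>Translation by \<open>e\<close> sends \<open>b1\<close> to \<open>a\<close>,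
      inside \<open>A\<close>, and \<open>b2\<close> to \<open>a + d\<close>, outside
      \<open>A\<close>.\<close>
    have "B1 \<subset> B'" using a adB' by (auto simp: B1_def)
    then have lt1: "card B1 < card B" using finB' cB' psubset_card_mono by metis
    have "min p (card A1 + card B1 - 1) \<le> card (sumset p A1 B1)"
      using less.prems B'p aB' a by (intro less.hyps lt1) (auto simp: A1_def B1_def)
    also have "card A1 + card B1 = card A + card B"
      using card_Un_Int[OF fin(1) finB'] cB' by (simp add: A1_def B1_def)
    also have "card (sumset p A1 B1) \<le> card (sumset p A B')"
    proof (intro card_mono finite_sumset fin finB' subsetI)
      fix z assume "z \<in> sumset p A1 B1"
      then obtain x y where xy: "x \<in> A1" "y \<in> B1" "z = (x + y) mod p" by (auto simp: sumset_def)
      show "z \<in> sumset p A B'"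
      proof (cases "x \<in> A")
        case True
        then show ?thesis using xy by (auto simp: B1_def intro: sumsetI)
      next
        case False
        then show ?thesis using xy sumsetI[of y A x B' p] by (auto simp: A1_def B1_def add.commute)
      qed
    qed
    also have "sumset p A B' = (\<lambda>z. (z + e) mod p) ` sumset p A B"
      by (auto simp: sumset_def B'_def image_iff mod_simps add.assoc; blast)
    also have "card \<dots> \<le> card (sumset p A B)" by (intro card_image_le finite_sumset fin)
    finally show ?thesis .
  qed
qed

text \<open>Pigeonhole: by Cauchy-Davenport the sumset of \<open>A\<close> and \<open>B\<close> and
  the set of all \<open>x - c\<close> have together more than \<open>p\<close> elements, so they
  meet.\<close>

lemma three_sums_cover:
  assumes "prime p" "A \<subseteq> {..<p}" "B \<subseteq> {..<p}" "C \<subseteq> {..<p}" "A \<noteq> {}" "B \<noteq> {}" "C \<noteq> {}"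
    and "card A + card B + card C \<ge> p + 2"
  shows "\<exists>a\<in>A. \<exists>b\<in>B. \<exists>c\<in>C. [x = a + b + c] (mod p)"
proof -
  have p: "p > 0" using assms(1) prime_gt_0_nat by blast
  define S where "S = sumset p A B"
  define g where "g = (\<lambda>c. (x + (p - c)) mod p)"
  have fin: "finite A" "finite B" "finite C" using assms finite_subset by blast+
  have "card C \<noteq> 0" using fin assms by simp
  then have card: "card S + card C > p"
    using Cauchy_Davenport[OF assms(1,2,3,5,6)] assms(8) by (simp add: S_def)
  have g: "[g c + c = x] (mod p)" if "c \<in> C" for c
  proof -
    have "[g c + c = x + (p - c) + c] (mod p)" by (simp add: g_def cong_def mod_simps)
    moreover have "x + (p - c) + c = x + p" using that assms by auto
    ultimately show ?thesis by (simp add: cong_def)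
  qed
  have "inj_on g C"
  proof (rule inj_onI)
    fix c c' assume c: "c \<in> C" "c' \<in> C" "g c = g c'"
    then have "[g c + c = g c + c'] (mod p)" using g[of c] g[of c'] cong_sym cong_trans by metis
    then have "[c = c'] (mod p)" by (simp add: cong_add_lcancel_nat)
    then show "c = c'" using c assms by (intro cong_less_modulus_unique_nat[of c c' p]) auto
  qed
  then have cg: "card (g ` C) = card C" by (rule card_image)
  have "S \<inter> g ` C \<noteq> {}"
  proof
    assume "S \<inter> g ` C = {}"
    then have "card (S \<union> g ` C) = card S + card C"
      using fin by (subst card_Un_disjoint) (auto simp: S_def finite_sumset cg)
    moreover have "S \<union> g ` C \<subseteq> {..<p}" using p by (auto simp: S_def sumset_def g_def)
    then have "card (S \<union> g ` C) \<le> card {..<p}" by (intro card_mono) auto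
    ultimately show False using card by simp
  qed
  then obtain c where "c \<in> C" "g c \<in> S" by blast
  then obtain a b where abc: "c \<in> C" "a \<in> A" "b \<in> B" "g c = (a + b) mod p"
    by (auto simp: S_def sumset_def)
  then have "[a + b + c = g c + c] (mod p)" by (simp add: cong_def mod_simps)
  then have "[x = a + b + c] (mod p)" using g[OF abc(1)] cong_sym cong_trans by metis
  then show ?thesis using abc by blast
qed

lemma ex_decreasing_enumeration:
  fixes f :: "nat \<Rightarrow> real"
  assumes "finite S"
  obtains e where "bij_betw e {..<card S} S" "\<And>i j. i \<le> j \<Longrightarrow> j < card S \<Longrightarrow> f (e j) \<le> f (e i)"
proof -
  define xs where "xs = sort_key (\<lambda>x. - f x) (sorted_list_of_set S)"
  have xs: "distinct xs" "set xs = S" "length xs = card S"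
    using assms by (simp_all add: xs_def)
  have "bij_betw ((!) xs) {..<card S} S"
    using bij_betw_nth[OF xs(1)] xs by auto
  moreover have "f (xs ! j) \<le> f (xs ! i)" if "i \<le> j" "j < card S" for i j
  proof -
    have "sorted (map (\<lambda>x. - f x) xs)" by (simp add: xs_def)
    then show ?thesis using that xs(3) sorted_iff_nth_mono[of "map (\<lambda>x. - f x) xs"] by auto
  qed
  ultimately show ?thesis by (rule that)
qed

section \<open>Transfer of positive score from averages to values\<close>

definition unit_avg :: "nat \<Rightarrow> (nat \<Rightarrow> real) \<Rightarrow> real" where
  "unit_avg m f = (\<Sum>a\<in>Zmod_units m. f a) / card (Zmod_units m)"

text \<open>Three functions appear because the product step restricts a function to three different
  fibres of the Chinese remainder map.\<close>

definition score_transfer :: "nat \<Rightarrow> bool" where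
  "score_transfer m \<longleftrightarrow> (\<forall>f g h :: nat \<Rightarrow> real.
     (\<forall>a\<in>Zmod_units m. f a \<in> {0..1} \<and> g a \<in> {0..1} \<and> h a \<in> {0..1}) \<longrightarrow>
     score (unit_avg m f) (unit_avg m g) (unit_avg m h) > 0 \<longrightarrow>
     (\<forall>x. \<exists>a\<in>Zmod_units m. \<exists>b\<in>Zmod_units m. \<exists>c\<in>Zmod_units m.
        [x = a + b + c] (mod m) \<and> score (f a) (g b) (h c) > 0))"

lemma score_transferD:
  assumes "score_transfer m" "\<And>a. a \<in> Zmod_units m \<Longrightarrow> f a \<in> {0..1}"
    "\<And>a. a \<in> Zmod_units m \<Longrightarrow> g a \<in> {0..1}" "\<And>a. a \<in> Zmod_units m \<Longrightarrow> h a \<in> {0..1}"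
    and "score (unit_avg m f) (unit_avg m g) (unit_avg m h) > 0"
  obtains a b c where "a \<in> Zmod_units m" "b \<in> Zmod_units m" "c \<in> Zmod_units m"
    "[x = a + b + c] (mod m)" "score (f a) (g b) (h c) > 0"
  using assms unfolding score_transfer_def by (metis (no_types, lifting))

lemma Zmod_units_iff: "a \<in> Zmod_units m \<longleftrightarrow> a < m \<and> coprime a m"
  by (auto simp: Zmod_units_def Zmod_def)

lemma finite_Zmod_units [simp]: "finite (Zmod_units m)"
  by (simp add: Zmod_units_def Zmod_def)

lemma Zmod_units_1 [simp]: "Zmod_units (Suc 0) = {0}"
  by (auto simp: Zmod_units_iff)

lemma Zmod_units_prime:
  assumes "prime p"
  shows "Zmod_units p = {0<..<p}"
proof -
  have "coprime x p" if "0 < x" "x < p" for x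
    using that assms prime_imp_coprime[of p x] nat_dvd_not_less[of x p] by (simp add: coprime_commute)
  moreover have "0 < x" if "coprime x p" for x
    using that assms by (intro gr0I) auto
  ultimately show ?thesis by (auto simp: Zmod_units_iff)
qed

text \<open>The bound \<open>p \<ge> 7\<close> supplies the six units that
  \<open>score_avg_nonpos\<close> asks for.\<close>

lemma score_transfer_prime:
  assumes p: "prime p" "p \<ge> 7"
  shows "score_transfer p"
  unfolding score_transfer_def
proof (intro allI impI)
  fix f g h :: "nat \<Rightarrow> real" and x
  assume range: "\<forall>a\<in>Zmod_units p. f a \<in> {0..1} \<and> g a \<in> {0..1} \<and> h a \<in> {0..1}"
    and avg: "score (unit_avg p f) (unit_avg p g) (unit_avg p h) > 0"
  define U where "U = Zmod_units p"
  define n where "n = card U"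
  have n: "n = p - 1" using p by (simp add: n_def U_def Zmod_units_prime)
  have Up: "U \<subseteq> {..<p}" by (auto simp: U_def Zmod_units_iff)
  have finU: "finite U" by (simp add: U_def)
  obtain e1 where e1: "bij_betw e1 {..<n} U" "\<And>i j. i \<le> j \<Longrightarrow> j < n \<Longrightarrow> f (e1 j) \<le> f (e1 i)"
    using ex_decreasing_enumeration[OF finU, of f] unfolding n_def by blast
  obtain e2 where e2: "bij_betw e2 {..<n} U" "\<And>i j. i \<le> j \<Longrightarrow> j < n \<Longrightarrow> g (e2 j) \<le> g (e2 i)"
    using ex_decreasing_enumeration[OF finU, of g] unfolding n_def by blast
  obtain e3 where e3: "bij_betw e3 {..<n} U" "\<And>i j. i \<le> j \<Longrightarrow> j < n \<Longrightarrow> h (e3 j) \<le> h (e3 i)"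
    using ex_decreasing_enumeration[OF finU, of h] unfolding n_def by blast
  have avgs: "unit_avg p f = (\<Sum>i<n. f (e1 i)) / n" "unit_avg p g = (\<Sum>i<n. g (e2 i)) / n"
    "unit_avg p h = (\<Sum>i<n. h (e3 i)) / n"
    using sum.reindex_bij_betw[OF e1(1), of f] sum.reindex_bij_betw[OF e2(1), of g]
      sum.reindex_bij_betw[OF e3(1), of h]
    by (simp_all add: unit_avg_def U_def n_def)
  have in_U: "e1 i \<in> U" "e2 i \<in> U" "e3 i \<in> U" if "i < n" for i
    using that bij_betwE[OF e1(1)] bij_betwE[OF e2(1)] bij_betwE[OF e3(1)] by auto
  have bounds: "f a \<in> {0..1}" "g a \<in> {0..1}" "h a \<in> {0..1}" if "a \<in> U" for a
    using range that by (auto simp: U_def)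
  have top: "card (e ` {..i}) = Suc i \<and> e ` {..i} \<subseteq> {..<p} \<and> e ` {..i} \<noteq> {}"
    if "bij_betw e {..<n} U" "i < n" for e i
  proof -
    have "{..i} \<subseteq> {..<n}" using that by auto
    then have "inj_on e {..i}" using that bij_betw_imp_inj_on inj_on_subset by metis
    moreover have "e ` {..i} \<subseteq> U" using \<open>{..i} \<subseteq> {..<n}\<close> that bij_betw_imp_surj_on by blast
    ultimately show ?thesis using Up by (auto simp: card_image)
  qed
  have "\<exists>i j k. i < n \<and> j < n \<and> k < n \<and> n \<le> i + j + k \<and> score (f (e1 i)) (g (e2 j)) (h (e3 k)) > 0"
  proof (rule ccontr)
    assume "\<not> ?thesis"
    then have "score (f (e1 i)) (g (e2 j)) (h (e3 k)) \<le> 0" if "i < n" "j < n" "k < n" "n \<le> i + j + k" for i j k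
      using that by (meson not_less)
    then have "score ((\<Sum>i<n. f (e1 i)) / n) ((\<Sum>i<n. g (e2 i)) / n) ((\<Sum>i<n. h (e3 i)) / n) \<le> 0"
      using p n by (intro score_avg_nonpos e1(2) e2(2) e3(2) bounds in_U) auto
    then show False using avg by (simp add: avgs)
  qed
  then obtain i j k where ijk: "i < n" "j < n" "k < n" "n \<le> i + j + k"
    and pos: "score (f (e1 i)) (g (e2 j)) (h (e3 k)) > 0" by blast
  \<comment> \<open>The initial segments have \<open>i + 1\<close>, \<open>j + 1\<close> and
    \<open>k + 1\<close> elements, in total at least \<open>n + 3 = p + 2\<close>.\<close>
  have "\<exists>a\<in>e1 ` {..i}. \<exists>b\<in>e2 ` {..j}. \<exists>c\<in>e3 ` {..k}. [x = a + b + c] (mod p)"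
    using p n ijk top[OF e1(1) ijk(1)] top[OF e2(1) ijk(2)] top[OF e3(1) ijk(3)]
    by (intro three_sums_cover) auto
  then obtain i' j' k' where le: "i' \<le> i" "j' \<le> j" "k' \<le> k"
    and x: "[x = e1 i' + e2 j' + e3 k'] (mod p)" by auto
  have lt: "i' < n" "j' < n" "k' < n" using le ijk by auto
  have "score (f (e1 i')) (g (e2 j')) (h (e3 k')) > 0"
    using bounds(1)[OF in_U(1)[OF ijk(1)]] bounds(2)[OF in_U(2)[OF ijk(2)]] bounds(3)[OF in_U(3)[OF ijk(3)]]
      bounds(1)[OF in_U(1)[OF lt(1)]] bounds(2)[OF in_U(2)[OF lt(2)]] bounds(3)[OF in_U(3)[OF lt(3)]]
    by (intro score_mono[OF pos] e1(2) e2(2) e3(2) le ijk) auto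
  then show "\<exists>a\<in>Zmod_units p. \<exists>b\<in>Zmod_units p. \<exists>c\<in>Zmod_units p.
      [x = a + b + c] (mod p) \<and> score (f a) (g b) (h c) > 0"
    using x in_U(1)[OF lt(1)] in_U(2)[OF lt(2)] in_U(3)[OF lt(3)] unfolding U_def by blast
qed

section \<open>Chinese remainder theorem for units and transfer to squarefree moduli\<close>

lemma bij_betw_Zmod_units_mult:
  assumes "m > 0" "n > 0" "coprime m n"
  shows "bij_betw (\<lambda>x. (x mod m, x mod n)) (Zmod_units (m * n)) (Zmod_units m \<times> Zmod_units n)"
proof (rule bij_betw_imageI)
  show "inj_on (\<lambda>x. (x mod m, x mod n)) (Zmod_units (m * n))"
  proof (rule inj_onI)
    fix x y assume xy: "x \<in> Zmod_units (m * n)" "y \<in> Zmod_units (m * n)"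
      "(x mod m, x mod n) = (y mod m, y mod n)"
    then have "[x = y] (mod m)" "[x = y] (mod n)" by (auto simp: cong_def)
    then have "[x = y] (mod m * n)" using assms by (simp add: coprime_cong_mult_nat)
    then show "x = y" using xy by (intro cong_less_modulus_unique_nat[of x y]) (auto simp: Zmod_units_iff)
  qed
  show "(\<lambda>x. (x mod m, x mod n)) ` Zmod_units (m * n) = Zmod_units m \<times> Zmod_units n" (is "?f ` _ = _")
  proof (intro equalityI subsetI)
    fix z assume "z \<in> ?f ` Zmod_units (m * n)"
    then show "z \<in> Zmod_units m \<times> Zmod_units n"
      using assms by (auto simp: Zmod_units_iff)
  next
    fix z assume z: "z \<in> Zmod_units m \<times> Zmod_units n"
    obtain a b where ab: "z = (a, b)" by (cases z)
    have ab': "a < m" "coprime a m" "b < n" "coprime b n" using z by (auto simp: ab Zmod_units_iff)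
    obtain x where x: "x < m * n" "[x = a] (mod m)" "[x = b] (mod n)"
      using binary_chinese_remainder_unique_nat[of m n a b] assms by auto
    have "coprime x m" "coprime x n"
      using x ab' cong_imp_coprime cong_sym by blast+
    then have "x \<in> Zmod_units (m * n)" using x by (simp add: Zmod_units_iff)
    moreover have "?f x = z" using x ab' by (simp add: ab cong_def)
    ultimately show "z \<in> ?f ` Zmod_units (m * n)" by force
  qed
qed

definition crt :: "nat \<Rightarrow> nat \<Rightarrow> nat \<times> nat \<Rightarrow> nat" where
  "crt m n = inv_into (Zmod_units (m * n)) (\<lambda>x. (x mod m, x mod n))"

lemma
  assumes "m > 0" "n > 0" "coprime m n"
  shows bij_betw_crt: "bij_betw (crt m n) (Zmod_units m \<times> Zmod_units n) (Zmod_units (m * n))"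
    and crt_cong: "a \<in> Zmod_units m \<Longrightarrow> b \<in> Zmod_units n \<Longrightarrow> [crt m n (a, b) = a] (mod m)"
      "a \<in> Zmod_units m \<Longrightarrow> b \<in> Zmod_units n \<Longrightarrow> [crt m n (a, b) = b] (mod n)"
proof -
  note bij = bij_betw_Zmod_units_mult[OF assms]
  show "bij_betw (crt m n) (Zmod_units m \<times> Zmod_units n) (Zmod_units (m * n))"
    unfolding crt_def by (rule bij_betw_inv_into[OF bij])
  assume "a \<in> Zmod_units m" "b \<in> Zmod_units n"
  then have "(\<lambda>x. (x mod m, x mod n)) (crt m n (a, b)) = (a, b)"
    unfolding crt_def by (intro bij_betw_inv_into_right[OF bij]) auto
  then have "crt m n (a, b) mod m = a" "crt m n (a, b) mod n = b" by auto
  then show "[crt m n (a, b) = a] (mod m)" "[crt m n (a, b) = b] (mod n)"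
    by (metis cong_mod_left cong_refl)+
qed

lemma crt_in_Zmod_units:
  assumes "m > 0" "n > 0" "coprime m n" "a \<in> Zmod_units m" "b \<in> Zmod_units n"
  shows "crt m n (a, b) \<in> Zmod_units (m * n)"
  using bij_betwE[OF bij_betw_crt[OF assms(1-3)]] assms(4,5) by blast

lemma crt_sum_cong:
  assumes "m > 0" "n > 0" "coprime m n" "a \<in> Zmod_units m" "b \<in> Zmod_units m" "c \<in> Zmod_units m"
    "a' \<in> Zmod_units n" "b' \<in> Zmod_units n" "c' \<in> Zmod_units n"
    "[x = a + b + c] (mod m)" "[x = a' + b' + c'] (mod n)"
  shows "[x = crt m n (a, a') + crt m n (b, b') + crt m n (c, c')] (mod m * n)"
proof (rule coprime_cong_mult_nat)
  have "[crt m n (a, a') + crt m n (b, b') + crt m n (c, c') = a + b + c] (mod m)"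
    using assms by (intro cong_add crt_cong)
  then show "[x = crt m n (a, a') + crt m n (b, b') + crt m n (c, c')] (mod m)"
    using assms cong_sym cong_trans by blast
  have "[crt m n (a, a') + crt m n (b, b') + crt m n (c, c') = a' + b' + c'] (mod n)"
    using assms by (intro cong_add crt_cong)
  then show "[x = crt m n (a, a') + crt m n (b, b') + crt m n (c, c')] (mod n)"
    using assms cong_sym cong_trans by blast
qed fact

lemma card_Zmod_units_mult:
  assumes "m > 0" "n > 0" "coprime m n"
  shows "card (Zmod_units (m * n)) = card (Zmod_units m) * card (Zmod_units n)"
  using bij_betw_same_card[OF bij_betw_Zmod_units_mult[OF assms]] by (simp add: card_cartesian_product)

lemma unit_avg_mult:
  assumes "m > 0" "n > 0" "coprime m n"
  shows "unit_avg (m * n) f = unit_avg m (\<lambda>a. unit_avg n (\<lambda>b. f (crt m n (a, b))))"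
proof -
  have "(\<Sum>x\<in>Zmod_units (m * n). f x) = (\<Sum>z\<in>Zmod_units m \<times> Zmod_units n. f (crt m n z))"
    using sum.reindex_bij_betw[OF bij_betw_crt[OF assms], of f] by simp
  also have "\<dots> = (\<Sum>a\<in>Zmod_units m. \<Sum>b\<in>Zmod_units n. f (crt m n (a, b)))"
    by (simp add: sum.cartesian_product)
  finally show ?thesis
    by (simp add: unit_avg_def card_Zmod_units_mult[OF assms] sum_divide_distrib mult.commute)
qed

lemma unit_avg_range:
  assumes "\<And>a. a \<in> Zmod_units m \<Longrightarrow> f a \<in> {0..1}"
  shows "unit_avg m f \<in> {0..1}"
proof -
  have "0 \<le> (\<Sum>a\<in>Zmod_units m. f a)" using assms by (intro sum_nonneg) auto
  moreover have "(\<Sum>a\<in>Zmod_units m. f a) \<le> of_nat (card (Zmod_units m)) * 1"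
    using assms by (intro sum_bounded_above) auto
  ultimately show ?thesis by (auto simp: unit_avg_def divide_le_eq_1)
qed

text \<open>Transfer modulo \<open>m\<close>, applied to the fibre averages, fixes residues modulo
  \<open>m\<close>; transfer modulo \<open>n\<close> then acts on the three chosen fibres.\<close>

lemma score_transfer_mult:
  assumes mn: "m > 0" "n > 0" "coprime m n" and "score_transfer m" "score_transfer n"
  shows "score_transfer (m * n)"
  unfolding score_transfer_def
proof (intro allI impI)
  fix f g h :: "nat \<Rightarrow> real" and x
  assume range: "\<forall>a\<in>Zmod_units (m * n). f a \<in> {0..1} \<and> g a \<in> {0..1} \<and> h a \<in> {0..1}"
    and avg: "score (unit_avg (m * n) f) (unit_avg (m * n) g) (unit_avg (m * n) h) > 0"
  have bounds: "f (crt m n (a, b)) \<in> {0..1}" "g (crt m n (a, b)) \<in> {0..1}" "h (crt m n (a, b)) \<in> {0..1}"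
    if "a \<in> Zmod_units m" "b \<in> Zmod_units n" for a b
    using range crt_in_Zmod_units[OF mn that] by auto
  obtain a b c where abc: "a \<in> Zmod_units m" "b \<in> Zmod_units m" "c \<in> Zmod_units m"
    "[x = a + b + c] (mod m)"
    "score (unit_avg n (\<lambda>b. f (crt m n (a, b)))) (unit_avg n (\<lambda>y. g (crt m n (b, y))))
      (unit_avg n (\<lambda>y. h (crt m n (c, y)))) > 0"
    using avg unfolding unit_avg_mult[OF mn]
    by (rule score_transferD[OF assms(4), rotated 3]) (auto intro!: unit_avg_range bounds simp del: atLeastAtMost_iff)
  obtain a' b' c' where abc': "a' \<in> Zmod_units n" "b' \<in> Zmod_units n" "c' \<in> Zmod_units n"
    "[x = a' + b' + c'] (mod n)" "score (f (crt m n (a, a'))) (g (crt m n (b, b'))) (h (crt m n (c, c'))) > 0"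
    using abc(5)
    by (rule score_transferD[OF assms(5), rotated 3]) (auto intro!: bounds abc simp del: atLeastAtMost_iff)
  show "\<exists>a\<in>Zmod_units (m * n). \<exists>b\<in>Zmod_units (m * n). \<exists>c\<in>Zmod_units (m * n).
      [x = a + b + c] (mod m * n) \<and> score (f a) (g b) (h c) > 0"
    using crt_sum_cong[OF mn abc(1-3) abc'(1-3) abc(4) abc'(4)] abc abc' crt_in_Zmod_units[OF mn]
    by blast
qed

lemma score_transfer_1: "score_transfer (Suc 0)"
  by (auto simp: score_transfer_def unit_avg_def)

lemma squarefree_mult_imp_coprime:
  fixes a b :: nat
  assumes "squarefree (a * b)"
  shows "coprime a b"
proof -
  have "(gcd a b)\<^sup>2 dvd a * b" unfolding power2_eq_square by (intro mult_dvd_mono) simp_all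
  then have "gcd a b dvd 1" using assms unfolding squarefree_def by blast
  then show ?thesis by (simp only: is_unit_gcd)
qed

text \<open>Prime factors are split off one at a time; coprimality to 30 excludes 2, 3 and
  5.\<close>

lemma score_transfer_squarefree:
  assumes "squarefree m" "coprime m 30"
  shows "score_transfer m"
  using assms
proof (induction m rule: less_induct)
  case (less m)
  show ?case
  proof (cases "m = 1")
    case True
    then show ?thesis by (simp add: score_transfer_1)
  next
    case False
    have m0: "m > 0" using less.prems(1) by (metis not_squarefree_0 gr0I)
    obtain p where p: "prime p" "p dvd m" using False prime_factor_nat by blast
    obtain k where k: "m = p * k" using p(2) by (auto elim: dvdE)
    have "coprime p 30" using p less.prems(2) by (metis coprime_divisors dvd_refl)
    have p7: "p \<ge> 7"
    proof (rule ccontr)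
      assume "\<not> p \<ge> 7"
      have "\<not> d dvd p" if "d dvd 30" "d \<noteq> 1" for d
        using that \<open>coprime p 30\<close> coprime_common_divisor_nat by blast
      from this[of 2] this[of 3] this[of 5] have "\<not> 2 dvd p" "\<not> 3 dvd p" "\<not> 5 dvd p" by auto
      moreover have "1 < p" using p(1) prime_gt_1_nat by blast
      ultimately show False using \<open>\<not> p \<ge> 7\<close> by presburger
    qed
    have "coprime p k" using less.prems(1) unfolding k by (rule squarefree_mult_imp_coprime)
    moreover have "k < m" using m0 p7 by (simp add: k)
    moreover have "squarefree k" using less.prems(1) k by (metis squarefree_multD(2) )
    moreover have "coprime k 30" using less.prems(2) by (simp add: k)
    ultimately show ?thesis
      using score_transfer_mult[of p k] score_transfer_prime[OF p(1) p7] less.IH m0 by (simp add: k)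
  qed
qed

section \<open>The modulus 15\<close>

text \<open>The index triples add up to 1 modulo 5. If all failed, the diagonal ones would bound
  three disjoint pairs by 5/4 each. This leaves \<open>u3\<close> and \<open>v1\<close>, as doubling
  3 would call for the third index 0; the mixed triples deal with them.\<close>

lemma unit_sum_one_mod_5:
  fixes u1 u2 u3 u4 v1 v2 v3 v4 :: real
  assumes b: "u1 \<in> {0..1}" "u2 \<in> {0..1}" "u3 \<in> {0..1}" "u4 \<in> {0..1}"
      "v1 \<in> {0..1}" "v2 \<in> {0..1}" "v3 \<in> {0..1}" "v4 \<in> {0..1}"
    and s: "u1 + u2 + u3 + u4 + v1 + v2 + v3 + v4 > 5"
  shows "score u1 u1 v4 > 0 \<or> score u2 u2 v2 > 0 \<or> score u4 u4 v3 > 0 \<or> score u2 u3 v1 > 0 \<or>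
    score u4 u3 v4 > 0 \<or> score u1 u3 v2 > 0 \<or> score u1 u2 v3 > 0"
proof (rule ccontr)
  assume n: "\<not> ?thesis"
  have b': "0 \<le> u1" "u1 \<le> 1" "0 \<le> u2" "u2 \<le> 1" "0 \<le> u3" "u3 \<le> 1" "0 \<le> u4" "u4 \<le> 1"
    "0 \<le> v1" "v1 \<le> 1" "0 \<le> v2" "v2 \<le> 1" "0 \<le> v3" "v3 \<le> 1" "0 \<le> v4" "v4 \<le> 1"
    using b by auto
  have d: "u1 + v4 \<le> 5/4" "u2 + v2 \<le> 5/4" "u4 + v3 \<le> 5/4"
    using n score_diag_pos[of u1 v4] score_diag_pos[of u2 v2] score_diag_pos[of u4 v3] b' by force+
  have t1: "u2 + u3 + 2 * v1 \<le> 5/2 \<or> 3 * u2 + u3 + 3 * v1 \<le> 4 \<or> u2 + 3 * u3 + 3 * v1 \<le> 4"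
    using score_nonpos_cases[of u2 u3 v1] n b' by auto
  have t3: "u4 + u3 + 2 * v4 \<le> 5/2 \<or> 3 * u4 + u3 + 3 * v4 \<le> 4 \<or> u4 + 3 * u3 + 3 * v4 \<le> 4"
    using score_nonpos_cases[of u4 u3 v4] n b' by auto
  have t4: "u1 + u3 + 2 * v2 \<le> 5/2 \<or> 3 * u1 + u3 + 3 * v2 \<le> 4 \<or> u1 + 3 * u3 + 3 * v2 \<le> 4"
    using score_nonpos_cases[of u1 u3 v2] n b' by auto
  have t5: "u1 + u2 + 2 * v3 \<le> 5/2 \<or> 3 * u1 + u2 + 3 * v3 \<le> 4 \<or> u1 + 3 * u2 + 3 * v3 \<le> 4"
    using score_nonpos_cases[of u1 u2 v3] n b' by auto
  have le1: "v2 \<le> 1" "v3 \<le> 1" "v4 \<le> 1" using b by auto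
  \<comment> \<open>Alternatives are refuted one after another by linear arithmetic: besides
    \<open>s\<close> and \<open>d\<close>, \<open>t4'\<close> uses \<open>t1'\<close>, and
    \<open>t3'\<close> uses both.\<close>
  have t1': "u2 + u3 + 2 * v1 \<le> 5/2 \<or> 3 * u2 + u3 + 3 * v1 \<le> 4"
    using t1 le1(1) s d by linarith
  have t4': "u1 + u3 + 2 * v2 \<le> 5/2 \<or> 3 * u1 + u3 + 3 * v2 \<le> 4"
    using t4
  proof (elim disjE)
    assume "u1 + 3 * u3 + 3 * v2 \<le> 4"
    with t1' have False using le1(1,3) s d by (elim disjE) linarith+
    then show ?thesis ..
  qed auto
  have t3': "u4 + u3 + 2 * v4 \<le> 5/2 \<or> 3 * u4 + u3 + 3 * v4 \<le> 4"
    using t3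
  proof (elim disjE)
    assume "u4 + 3 * u3 + 3 * v4 \<le> 4"
    with t1' t4' have False using le1(2,3) s d by (elim disjE) linarith+
    then show ?thesis ..
  qed auto
  have "u2 + u3 + 2 * v1 \<le> 5/2"
    using t1'
  proof (elim disjE)
    assume "3 * u2 + u3 + 3 * v1 \<le> 4"
    with t3' t4' have False using le1(2,3) s d(1,3) by (elim disjE) linarith+
    then show ?thesis ..
  qed auto
  with t4' t3' t5 show False using le1(2) s d by (elim disjE) linarith+
qed

lemma ex_unit_sum_one_mod_5:
  fixes u v :: "nat \<Rightarrow> real"
  assumes "\<And>i. i \<in> {1..4} \<Longrightarrow> u i \<in> {0..1}" "\<And>i. i \<in> {1..4} \<Longrightarrow> v i \<in> {0..1}"
    and "u 1 + u 2 + u 3 + u 4 + v 1 + v 2 + v 3 + v 4 > 5"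
  shows "\<exists>a\<in>{1..4}. \<exists>b\<in>{1..4}. \<exists>c\<in>{1..4}. (a + b + c) mod 5 = 1 \<and> score (u a) (u b) (v c) > 0"
proof -
  have S: "{1..4::nat} = {1, 2, 3, 4}" by auto
  have "score (u 1) (u 1) (v 4) > 0 \<or> score (u 2) (u 2) (v 2) > 0 \<or> score (u 4) (u 4) (v 3) > 0 \<or>
    score (u 2) (u 3) (v 1) > 0 \<or> score (u 4) (u 3) (v 4) > 0 \<or> score (u 1) (u 3) (v 2) > 0 \<or>
    score (u 1) (u 2) (v 3) > 0"
    using assms(3) by (intro unit_sum_one_mod_5 assms(1,2)) auto
  then show ?thesis unfolding S by (elim disjE) (simp_all del: One_nat_def)
qed

text \<open>Multiplication by a nonzero residue permutes the units modulo 5, which reduces every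
  nonzero target to the target 1.\<close>

lemma ex_unit_sum_mod_5:
  fixes u v :: "nat \<Rightarrow> real"
  assumes u: "\<And>i. i \<in> {1..4} \<Longrightarrow> u i \<in> {0..1}" and v: "\<And>i. i \<in> {1..4} \<Longrightarrow> v i \<in> {0..1}"
    and s: "(\<Sum>i\<in>{1..4}. u i) + (\<Sum>i\<in>{1..4}. v i) > 5"
  shows "\<exists>a\<in>{1..4}. \<exists>b\<in>{1..4}. \<exists>c\<in>{1..4}. [x = a + b + c] (mod 5) \<and> score (u a) (u b) (v c) > 0"
proof -
  have S: "{1..4::nat} = {1, 2, 3, 4}" by auto
  have s': "u 1 + u 2 + u 3 + u 4 + v 1 + v 2 + v 3 + v 4 > 5"
    using s by (simp add: S del: One_nat_def)
  define r where "r = x mod 5"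
  have "r < 5" by (simp add: r_def)
  then consider "r = 0" | "r \<in> {1, 2, 3, 4}" by fastforce
  then show ?thesis
  proof cases
    case 1
    have d: "score (u i) (u i) (v j) > 0" if "i \<in> {1..4}" "j \<in> {1..4}" "u i + v j > 5/4" for i j
      using u[OF that(1)] v[OF that(2)] that(3) by (intro score_diag_pos) auto
    \<comment> \<open>In each pair \<open>2 * i + j\<close> is 0 modulo 5, and the four pairs use
      all eight values once, so one of them exceeds 5/4.\<close>
    have "u 1 + v 3 > 5/4 \<or> u 2 + v 1 > 5/4 \<or> u 3 + v 4 > 5/4 \<or> u 4 + v 2 > 5/4"
      using s' by linarith
    then have "score (u 1) (u 1) (v 3) > 0 \<or> score (u 2) (u 2) (v 1) > 0 \<or>
        score (u 3) (u 3) (v 4) > 0 \<or> score (u 4) (u 4) (v 2) > 0"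
      using d[of 1 3] d[of 2 1] d[of 3 4] d[of 4 2] by auto
    then show ?thesis using 1 unfolding S r_def cong_def by (elim disjE) (simp_all del: One_nat_def)
  next
    case 2
    have r: "r * i mod 5 \<in> {1..4}" if "i \<in> {1..4}" for i
      using 2 that unfolding S by (elim insertE emptyE) simp_all
    have "\<exists>a\<in>{1..4}. \<exists>b\<in>{1..4}. \<exists>c\<in>{1..4}. (a + b + c) mod 5 = 1 \<and>
        score (u (r * a mod 5)) (u (r * b mod 5)) (v (r * c mod 5)) > 0"
    proof (rule ex_unit_sum_one_mod_5)
      show "u (r * 1 mod 5) + u (r * 2 mod 5) + u (r * 3 mod 5) + u (r * 4 mod 5) +
          v (r * 1 mod 5) + v (r * 2 mod 5) + v (r * 3 mod 5) + v (r * 4 mod 5) > 5"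
        using 2 s' by (elim insertE emptyE) simp_all
    qed (intro u v r; assumption)+
    then obtain a b c where abc: "a \<in> {1..4}" "b \<in> {1..4}" "c \<in> {1..4}" "(a + b + c) mod 5 = 1"
      "score (u (r * a mod 5)) (u (r * b mod 5)) (v (r * c mod 5)) > 0"
      by blast
    have "[r * a mod 5 + r * b mod 5 + r * c mod 5 = r * a + r * b + r * c] (mod 5)"
      by (intro cong_add) (simp_all add: cong_def)
    then have "(r * a mod 5 + r * b mod 5 + r * c mod 5) mod 5 = r * (a + b + c) mod 5"
      by (simp add: cong_def algebra_simps)
    also have "\<dots> = r * ((a + b + c) mod 5) mod 5" by (simp add: mod_simps)
    also have "\<dots> = x mod 5" by (simp add: abc(4) r_def)
    finally show ?thesis using abc(5) r[OF abc(1)] r[OF abc(2)] r[OF abc(3)] unfolding cong_def by metis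
  qed
qed

section \<open>From modulus 5 to modulus 15 and its divisors\<close>

lemma coprime_15_iff: "coprime a 15 \<longleftrightarrow> \<not> 3 dvd a \<and> \<not> 5 dvd a" for a :: nat
proof -
  have "coprime a q \<longleftrightarrow> \<not> q dvd a" if "prime q" for q :: nat
    using that by (metis coprime_commute coprime_absorb_left not_prime_unit prime_imp_coprime)
  from this[of 3] this[of 5] show ?thesis
    using coprime_mult_right_iff[of a 3 5] by simp
qed

lemma Zmod_units_15: "Zmod_units 15 = {1, 2, 4, 7, 8, 11, 13, 14}"
proof -
  have "a \<in> Zmod_units 15 \<longleftrightarrow> a \<in> {1, 2, 4, 7, 8, 11, 13, 14}" for a
    unfolding Zmod_units_iff coprime_15_iff insert_iff empty_iff by presburger
  then show ?thesis by blast
qed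

lemma ex_score_pos_mod_15:
  assumes f: "\<And>a. a \<in> Zmod_units 15 \<Longrightarrow> f a \<in> {0..1}" and s: "(\<Sum>a\<in>Zmod_units 15. f a) > (5::real)"
  shows "\<exists>a\<in>Zmod_units 15. \<exists>b\<in>Zmod_units 15. \<exists>c\<in>Zmod_units 15.
    [x = a + b + c] (mod 15) \<and> score (f a) (f b) (f c) > 0"
proof -
  have S: "{1..4::nat} = {1, 2, 3, 4}" by auto
  \<comment> \<open>\<open>pt t i\<close> is congruent to \<open>t\<close> modulo 3 and to \<open>i\<close> modulo 5.\<close>
  define pt where "pt = (\<lambda>t i :: nat. (10 * t + 6 * i) mod 15)"
  define W where "W = (\<lambda>t. \<Sum>i\<in>{1..4}. f (pt t i))"
  have W: "W 1 + W 2 > 5"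
    using s unfolding W_def S pt_def Zmod_units_15 by simp
  have pt: "pt t i \<in> Zmod_units 15" if "t \<in> {1, 2}" "i \<in> {1..4}" for t i
    using that unfolding S pt_def Zmod_units_15 by auto
  \<comment> \<open>Two summands are taken from class \<open>t\<close> modulo 3 and one from class
    \<open>t'\<close>, which leaves a problem modulo 5.\<close>
  have main: ?thesis if t: "t \<in> {1, 2}" "t' \<in> {1, 2}" and "W t + W t' > 5" and x: "[x = 2 * t + t'] (mod 3)" for t t'
  proof -
    have "\<exists>a\<in>{1..4}. \<exists>b\<in>{1..4}. \<exists>c\<in>{1..4}. [x = a + b + c] (mod 5) \<and>
        score (f (pt t a)) (f (pt t b)) (f (pt t' c)) > 0"
      using that(3) f pt t by (intro ex_unit_sum_mod_5) (auto simp: W_def simp del: atLeastAtMost_iff)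
    then obtain a b c where abc: "a \<in> {1..4}" "b \<in> {1..4}" "c \<in> {1..4}" "[x = a + b + c] (mod 5)"
        "score (f (pt t a)) (f (pt t b)) (f (pt t' c)) > 0" by blast
    \<comment> \<open>Scaling by 10 and 6 gives both congruences the modulus 30, and
      \<open>10 * x + 6 * x\<close> is \<open>x\<close> modulo 15.\<close>
    have "[10 * x = 10 * (2 * t + t')] (mod 30)"
      using cong_cmult_leftI[OF x, of 10] by simp
    moreover have "[6 * x = 6 * (a + b + c)] (mod 30)"
      using cong_cmult_leftI[OF abc(4), of 6] by simp
    ultimately have "[10 * x + 6 * x = 10 * (2 * t + t') + 6 * (a + b + c)] (mod 30)"
      by (rule cong_add)
    then have "[10 * x + 6 * x = 10 * (2 * t + t') + 6 * (a + b + c)] (mod 15)"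
      by (rule cong_dvd_modulus_nat) auto
    moreover have "10 * x + 6 * x = x + x * 15" by simp
    then have "[x = 10 * x + 6 * x] (mod 15)" unfolding cong_def by (simp only: mod_mult_self1)
    moreover have "[(10 * t + 6 * a) + (10 * t + 6 * b) + (10 * t' + 6 * c) =
        pt t a + pt t b + pt t' c] (mod 15)"
      by (intro cong_add) (simp_all add: cong_def pt_def)
    then have "[10 * (2 * t + t') + 6 * (a + b + c) = pt t a + pt t b + pt t' c] (mod 15)"
      by (simp add: algebra_simps)
    ultimately have "[x = pt t a + pt t b + pt t' c] (mod 15)" using cong_trans by blast
    then show ?thesis using abc pt t by blast
  qed
  consider "x mod 3 = 0" | "x mod 3 = 1" | "x mod 3 = 2" by linarith
  then show ?thesis
  proof cases
    case 1
    \<comment> \<open>Both \<open>t = t' = 1\<close> and \<open>t = t' = 2\<close> give 0 modulo 3;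
      the class with the larger total is used.\<close>
    then show ?thesis using main[of 1 1] main[of 2 2] W by (cases "W 1 \<ge> W 2") (auto simp: cong_def)
  next
    case 2
    then show ?thesis using main[of 1 2] W by (auto simp: cong_def)
  next
    case 3
    then show ?thesis using main[of 2 1] W by (auto simp: cong_def)
  qed
qed

text \<open>Reduction modulo \<open>d\<close> maps the 8 units modulo 15 evenly onto those modulo
  \<open>d\<close>; this is checked by enumeration.\<close>

lemma sum_Zmod_units_15_mod:
  fixes f :: "nat \<Rightarrow> real"
  assumes "d dvd 15"
  shows "(\<Sum>a\<in>Zmod_units 15. f (a mod d)) = 8 * unit_avg d f"
proof -
  have "d \<in> {1, 3, 5, 15}"
  proof -
    have "d \<le> 15" using assms by (auto dest: dvd_imp_le)
    then have "d \<in> {0, 1, 2, 3, 4, 5, 6, 7, 8, 9, 10, 11, 12, 13, 14, 15}"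
      unfolding insert_iff empty_iff by presburger
    then show ?thesis using assms by auto
  qed
  moreover have "Zmod_units 3 = {1, 2}" "Zmod_units 5 = {1, 2, 3, 4}"
    by (subst Zmod_units_prime; force)+
  ultimately show ?thesis
    by (auto simp: unit_avg_def Zmod_units_15 simp del: One_nat_def) (simp_all add: numeral_2_eq_2)
qed

text \<open>Pulling \<open>f\<close> back to the modulus 15 turns the average 5/8 into the total
  5.\<close>

lemma ex_score_pos_dvd_15:
  assumes d: "d dvd 15" and f: "\<And>a. a \<in> Zmod_units d \<Longrightarrow> f a \<in> {0..1}" and s: "unit_avg d f > 5/8"
  shows "\<exists>a\<in>Zmod_units d. \<exists>b\<in>Zmod_units d. \<exists>c\<in>Zmod_units d.
    [x = a + b + c] (mod d) \<and> score (f a) (f b) (f c) > 0"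
proof -
  have "d > 0" using d by (intro gr0I) auto
  then have unit: "a mod d \<in> Zmod_units d" if "a \<in> Zmod_units 15" for a
    using that d coprime_divisors[of a a d 15] by (simp add: Zmod_units_iff)
  obtain a b c where abc: "a \<in> Zmod_units 15" "b \<in> Zmod_units 15" "c \<in> Zmod_units 15"
    "[x = a + b + c] (mod 15)" "score (f (a mod d)) (f (b mod d)) (f (c mod d)) > 0"
    using ex_score_pos_mod_15[of "\<lambda>a. f (a mod d)" x] unit f s sum_Zmod_units_15_mod[OF d, of f] by auto
  have "[x = a + b + c] (mod d)" using abc(4) d by (rule cong_dvd_modulus_nat)
  moreover have "[a + b + c = a mod d + b mod d + c mod d] (mod d)"
    by (intro cong_add) (simp_all add: cong_def)
  ultimately have "[x = a mod d + b mod d + c mod d] (mod d)" by (rule cong_trans)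
  then show ?thesis using abc unit by blast
qed

section \<open>Combining a divisor of 15 with a cofactor coprime to 30\<close>

lemma card_Zmod_units: "m > 0 \<Longrightarrow> card (Zmod_units m) = totient m"
proof (cases "m = 1")
  case False
  assume "m > 0"
  then have "Zmod_units m = totatives m"
    using False by (auto simp: Zmod_units_iff totatives_def intro!: gr0I le_neq_trans)
  then show ?thesis by (simp add: totient_def)
qed auto

theorem proposition1p4:
  fixes m :: nat and f :: "nat \<Rightarrow> real"
  assumes "m > 0" and "odd m" and "squarefree m"
    and "\<forall>a\<in>Zmod_units m. f a \<in> {0..1}"
    and "(\<Sum>a\<in>Zmod_units m. f a) > 5 / 8 * real (totient m)"
  shows "\<forall>x\<in>Zmod m. \<exists>a1\<in>Zmod_units m. \<exists>a2\<in>Zmod_units m. \<exists>a3\<in>Zmod_units m.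
           [x = a1 + a2 + a3] (mod m) \<and>
           f a1 * f a2 * f a3 > 0 \<and> f a1 + f a2 + f a3 > 3 / 2"
proof
  fix x
  \<comment> \<open>By squarefreeness \<open>d\<close> absorbs the factors 3 and 5, and as
    \<open>m\<close> is odd the cofactor \<open>k\<close> is coprime to 30.\<close>
  define d where "d = gcd m 15"
  define k where "k = m div d"
  have d15: "d dvd 15" by (simp add: d_def)
  have m: "m = d * k" by (simp add: d_def k_def)
  have d0: "d > 0" and k0: "k > 0" using \<open>m > 0\<close> m by auto
  have dk: "coprime d k"
    using \<open>squarefree m\<close> unfolding m by (rule squarefree_mult_imp_coprime)
  have sqk: "squarefree k" using \<open>squarefree m\<close> m by (metis squarefree_multD(2))
  have not_dvd: "\<not> q dvd k" if "prime q" "q dvd 15" for q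
  proof
    assume "q dvd k"
    then have "q dvd m" unfolding m by (rule dvd_mult)
    then have "q dvd d" unfolding d_def using that(2) by (rule gcd_greatest)
    then show False using \<open>q dvd k\<close> dk that coprime_common_divisor_nat not_prime_1 by metis
  qed
  have "coprime k 15" unfolding coprime_15_iff using not_dvd[of 3] not_dvd[of 5] by simp
  moreover have "coprime k 2" using \<open>odd m\<close> by (simp add: m)
  ultimately have "coprime k (2 * 15)" by (simp only: coprime_mult_right_iff)
  then have "coprime k 30" by simp
  then have transfer: "score_transfer k" by (rule score_transfer_squarefree[OF sqk])
  have bounds: "f (crt d k (a, b)) \<in> {0..1}" if "a \<in> Zmod_units d" "b \<in> Zmod_units k" for a b
    using assms(4) crt_in_Zmod_units[OF d0 k0 dk that] by (simp add: m)
  have "unit_avg m f > 5/8"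
    using assms(5) \<open>m > 0\<close> by (simp add: unit_avg_def card_Zmod_units field_simps)
  \<comment> \<open>Residues modulo \<open>d\<close> are chosen first, by the averages over their
    fibres; transfer modulo \<open>k\<close> then picks points in these fibres.\<close>
  then have avg: "unit_avg d (\<lambda>a. unit_avg k (\<lambda>b. f (crt d k (a, b)))) > 5/8"
    using unit_avg_mult[OF d0 k0 dk, of f] by (simp add: m)
  have "unit_avg k (\<lambda>b. f (crt d k (a, b))) \<in> {0..1}" if "a \<in> Zmod_units d" for a
    by (intro unit_avg_range bounds that)
  from ex_score_pos_dvd_15[OF d15 this avg, of x] obtain a b c where
    abc: "a \<in> Zmod_units d" "b \<in> Zmod_units d" "c \<in> Zmod_units d" "[x = a + b + c] (mod d)"
    "score (unit_avg k (\<lambda>y. f (crt d k (a, y)))) (unit_avg k (\<lambda>y. f (crt d k (b, y))))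
      (unit_avg k (\<lambda>y. f (crt d k (c, y)))) > 0"
    by blast
  obtain a' b' c' where abc': "a' \<in> Zmod_units k" "b' \<in> Zmod_units k" "c' \<in> Zmod_units k"
    "[x = a' + b' + c'] (mod k)"
    "score (f (crt d k (a, a'))) (f (crt d k (b, b'))) (f (crt d k (c, c'))) > 0"
    using abc(5)
    by (rule score_transferD[OF transfer, rotated 3]) (auto intro!: bounds abc simp del: atLeastAtMost_iff)
  define a1 where "a1 = crt d k (a, a')"
  define a2 where "a2 = crt d k (b, b')"
  define a3 where "a3 = crt d k (c, c')"
  have units: "a1 \<in> Zmod_units m" "a2 \<in> Zmod_units m" "a3 \<in> Zmod_units m"
    unfolding a1_def a2_def a3_def m using abc abc' by (auto intro!: crt_in_Zmod_units d0 k0 dk)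
  have "[x = a1 + a2 + a3] (mod m)"
    unfolding a1_def a2_def a3_def m using abc abc' by (intro crt_sum_cong d0 k0 dk)
  moreover have pos: "score (f a1) (f a2) (f a3) > 0" using abc'(5) by (simp add: a1_def a2_def a3_def)
  have r: "0 \<le> f a1" "f a1 \<le> 1" "0 \<le> f a2" "f a2 \<le> 1" "0 \<le> f a3" "f a3 \<le> 1"
    using units assms(4) by auto
  have "f a1 > 0" "f a2 > 0" "f a3 > 0" "f a1 + f a2 + f a3 > 3 / 2"
    using score_pos_left[OF pos r] score_pos_left[of "f a2" "f a1" "f a3"] score_pos_last[OF pos r]
      score_pos_sum[OF pos r] pos r score_commute by auto
  ultimately show "\<exists>a1\<in>Zmod_units m. \<exists>a2\<in>Zmod_units m. \<exists>a3\<in>Zmod_units m.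
           [x = a1 + a2 + a3] (mod m) \<and> f a1 * f a2 * f a3 > 0 \<and> f a1 + f a2 + f a3 > 3 / 2"
    using units by (intro bexI[of _ a1] bexI[of _ a2] bexI[of _ a3]) auto
qed

end
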